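(* Let $V$ be a finite-dimensional complex vector space and let $\hat R\in \mathrm{Aut}(V^{\otimes 2})$ be a skew invertible R-matrix of BMW type, with parameters $q\in\mathbb C\setminus\{0,\pm1\}$ and $\nu\in\mathbb C\setminus\{0,q,-q^{-1}\}$. Put $\lambda:=q-q^{-1}$ and $$\hat K:=\lambda^{-1}\nu^{-1}(qI-\hat R)(q^{-1}I+\hat R)\in\mathrm{End}(V^{\otimes 2}).$$ Then the rank of the operator $\hat K$ equals $1$.
   Context: Notation. $V$ is a finite-dimensional vector space over $\mathbb C$. For $X\in\mathrm{End}(V^{\otimes 2})$ and $1\le k\ne l\le n$, $X_{kl}\in\mathrm{End}(V^{\otimes n})$ acts as $X$ on the tensor product of the $k$-th and $l$-th factors and as the identity on the other factors; $X_k:=X_{k\,k+1}$. $I$ is the identity operator, $P\in \mathrm{Aut}(V^{\otimes 2})$ is the permutation $P(u\otimes v)=v\otimes u$, and $\mathrm{Tr}_{(i)}$ is the partial trace over the $i$-th tensor factor. R-matrix. An element $\hat R\in\mathrm{Aut}(V^{\otimes 2})$ is an R-matrix if $\hat R_1\hat R_2\hat R_1=\hat R_2\hat R_1\hat R_2$ in $\mathrm{End}(V^{\otimes 3})$. Skew invertibility. $\hat R\in\mathrm{Aut}(V^{\otimes 2})$ is skew invertible if there exists $\hat\Psi\in\mathrm{End}(V^{\otimes 2})$ with $\mathrm{Tr}_{(2)}(\hat R_{12}\hat\Psi_{23})=\mathrm{Tr}_{(2)}(\hat\Psi_{12}\hat R_{23})=P_{13}$. Birman-Murakami-Wenzl algebra.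 For $q\in\mathbb C\setminus\{0,\pm1\}$, $\nu\in\mathbb C\setminus\{0,q,-q^{-1}\}$, $\lambda:=q-q^{-1}$, the algebra $W_n(q,\nu)$ is the quotient of the group algebra of the braid group on $n$ strands, given by generators $e_i$ (invertible) and $\kappa_i$, $i=1,\dots,n-1$, and relations $$e_ie_{i+1}e_i=e_{i+1}e_ie_{i+1},\qquad e_ie_j=e_je_i\ (|i-j|>1),\qquad e_i^2=1+\lambda(e_i-\nu\kappa_i),$$ $$e_i\kappa_i=\kappa_ie_i=\nu\kappa_i,\qquad \kappa_{i+1}e_i\kappa_{i+1}=\nu^{-1}\kappa_{i+1},\qquad \kappa_{i+1}e_i^{-1}\kappa_{i+1}=\nu\,\kappa_{i+1}.$$ In particular $\kappa_i=\lambda^{-1}\nu^{-1}(q-e_i)(q^{-1}+e_i)$. BMW type. An R-matrix $\hat R$ is of BMW type (with parameters $q,\nu$) if its minimal polynomial has degree $3$ and, for every $n$, the assignment $e_i\mapsto\hat R_i$ (hence $\kappa_i\mapsto\hat K_i$, where $\hat K=\lambda^{-1}\nu^{-1}(qI-\hat R)(q^{-1}I+\hat R)$) defines a representation of $W_n(q,\nu)$ on $V^{\otimes n}$. *)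

theory Defs
  imports Complex_Main "Jordan_Normal_Form.DL_Rank"
begin

text \<open>
  \<open>V = \<complex>\<^sup>d\<close> with its standard basis \<open>v\<^sub>0, \<dots>, v\<^sub>d\<^sub>-\<^sub>1\<close>, and \<open>V\<^sup>\<otimes>\<^sup>n\<close> is \<open>\<complex>\<close> to the power \<open>d ^ n\<close>: the basis tensor
  \<open>v\<^bsub>a 1\<^esub> \<otimes> \<dots> \<otimes> v\<^bsub>a n\<^esub>\<close> has the index with base-\<open>d\<close> digits \<open>a 1, \<dots>, a n\<close>, the first factor
  being the most significant digit. Endomorphisms are identified with their matrices.
  Tensor factors and the generators of the algebra are numbered from 1, as usual.
\<close>

definition tensor_digit :: "nat \<Rightarrow> nat \<Rightarrow> nat \<Rightarrow> nat \<Rightarrow> nat" where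
  "tensor_digit d n k i = (i div d ^ (n - k)) mod d"

definition on_factors :: "nat \<Rightarrow> nat \<Rightarrow> nat \<Rightarrow> nat \<Rightarrow> complex mat \<Rightarrow> complex mat" where
  "on_factors d n k l X = mat (d ^ n) (d ^ n) (\<lambda>(i, j).
     if \<forall>m \<in> {1..n} - {k, l}. tensor_digit d n m i = tensor_digit d n m j
     then X $$ (tensor_digit d n k i * d + tensor_digit d n l i,
                tensor_digit d n k j * d + tensor_digit d n l j)
     else 0)"

abbreviation on_adjacent :: "nat \<Rightarrow> nat \<Rightarrow> nat \<Rightarrow> complex mat \<Rightarrow> complex mat" where
  "on_adjacent d n k X \<equiv> on_factors d n k (k + 1) X"

definition flip_mat :: "nat \<Rightarrow> complex mat" where
  "flip_mat d = mat (d ^ 2) (d ^ 2) (\<lambda>(i, j).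
     if tensor_digit d 2 1 i = tensor_digit d 2 2 j \<and> tensor_digit d 2 2 i = tensor_digit d 2 1 j
     then 1 else 0)"

text \<open>
  \<open>insert_digit d n k a i\<close> is the index of the basis tensor of \<open>V\<^sup>\<otimes>\<^sup>n\<close> obtained from the one with
  index \<open>i\<close> in the \<open>(n - 1)\<close>-st tensor power by inserting \<open>v\<^sub>a\<close> as the new \<open>k\<close>-th factor.
\<close>

definition insert_digit :: "nat \<Rightarrow> nat \<Rightarrow> nat \<Rightarrow> nat \<Rightarrow> nat \<Rightarrow> nat" where
  "insert_digit d n k a i = ((i div d ^ (n - k)) * d + a) * d ^ (n - k) + i mod d ^ (n - k)"

definition partial_trace :: "nat \<Rightarrow> nat \<Rightarrow> nat \<Rightarrow> complex mat \<Rightarrow> complex mat" where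
  "partial_trace d n k A = mat (d ^ (n - 1)) (d ^ (n - 1)) (\<lambda>(i, j).
     \<Sum>a<d. A $$ (insert_digit d n k a i, insert_digit d n k a j))"

definition R_matrix :: "nat \<Rightarrow> complex mat \<Rightarrow> bool" where
  "R_matrix d R \<longleftrightarrow> R \<in> carrier_mat (d ^ 2) (d ^ 2) \<and> invertible_mat R \<and>
     on_adjacent d 3 1 R * on_adjacent d 3 2 R * on_adjacent d 3 1 R =
     on_adjacent d 3 2 R * on_adjacent d 3 1 R * on_adjacent d 3 2 R"

text \<open>
  The trace over the second factor of an endomorphism of \<open>V\<^sup>\<otimes>\<^sup>3\<close> is an endomorphism of the tensor
  product of the first and third factors; there the flip of these two is \<open>flip_mat d\<close>.
\<close>

definition skew_invertible :: "nat \<Rightarrow> complex mat \<Rightarrow> bool" where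
  "skew_invertible d R \<longleftrightarrow> (\<exists>\<Psi> \<in> carrier_mat (d ^ 2) (d ^ 2).
     partial_trace d 3 2 (on_factors d 3 1 2 R * on_factors d 3 2 3 \<Psi>) = flip_mat d \<and>
     partial_trace d 3 2 (on_factors d 3 1 2 \<Psi> * on_factors d 3 2 3 R) = flip_mat d)"

definition poly_at_mat :: "complex poly \<Rightarrow> complex mat \<Rightarrow> complex mat" where
  "poly_at_mat p A = mat (dim_row A) (dim_row A) (\<lambda>(i, j).
     \<Sum>k\<le>degree p. coeff p k * (A ^\<^sub>m k) $$ (i, j))"

definition annihilates :: "complex poly \<Rightarrow> complex mat \<Rightarrow> bool" where
  "annihilates p A \<longleftrightarrow> poly_at_mat p A = 0\<^sub>m (dim_row A) (dim_row A)"

definition is_minimal_poly :: "complex poly \<Rightarrow> complex mat \<Rightarrow> bool" where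
  "is_minimal_poly p A \<longleftrightarrow> lead_coeff p = 1 \<and> annihilates p A \<and> (\<forall>r. annihilates r A \<longrightarrow> p dvd r)"

text \<open>
  A representation of \<open>W\<^sub>n(q,\<nu>)\<close> on \<open>\<complex>\<^sup>N\<close>, given by the images \<open>e i\<close>, \<open>e' i\<close>, \<open>\<kappa> i\<close> of the generators
  \<open>e\<^sub>i\<close>, their inverses and \<open>\<kappa>\<^sub>i\<close> (\<open>1 \<le> i \<le> n - 1\<close>): these have to satisfy the defining relations.
\<close>

definition BMW_representation ::
  "complex \<Rightarrow> complex \<Rightarrow> nat \<Rightarrow> nat \<Rightarrow> (nat \<Rightarrow> complex mat) \<Rightarrow> (nat \<Rightarrow> complex mat) \<Rightarrow>
     (nat \<Rightarrow> complex mat) \<Rightarrow> bool" where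
  "BMW_representation q \<nu> n N e e' \<kappa> \<longleftrightarrow>
     (\<forall>i \<in> {1..<n}. e i \<in> carrier_mat N N \<and> e' i \<in> carrier_mat N N \<and> \<kappa> i \<in> carrier_mat N N) \<and>
     (\<forall>i \<in> {1..<n}. e i * e' i = 1\<^sub>m N \<and> e' i * e i = 1\<^sub>m N) \<and>
     (\<forall>i. i \<in> {1..<n} \<and> i + 1 \<in> {1..<n} \<longrightarrow>
        e i * e (i + 1) * e i = e (i + 1) * e i * e (i + 1)) \<and>
     (\<forall>i \<in> {1..<n}. \<forall>j \<in> {1..<n}. \<bar>int i - int j\<bar> > 1 \<longrightarrow> e i * e j = e j * e i) \<and>
     (\<forall>i \<in> {1..<n}. e i * e i = 1\<^sub>m N + (q - inverse q) \<cdot>\<^sub>m (e i - \<nu> \<cdot>\<^sub>m \<kappa> i)) \<and>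
     (\<forall>i \<in> {1..<n}. e i * \<kappa> i = \<nu> \<cdot>\<^sub>m \<kappa> i \<and> \<kappa> i * e i = \<nu> \<cdot>\<^sub>m \<kappa> i) \<and>
     (\<forall>i. i \<in> {1..<n} \<and> i + 1 \<in> {1..<n} \<longrightarrow>
        \<kappa> (i + 1) * e i * \<kappa> (i + 1) = inverse \<nu> \<cdot>\<^sub>m \<kappa> (i + 1) \<and>
        \<kappa> (i + 1) * e' i * \<kappa> (i + 1) = \<nu> \<cdot>\<^sub>m \<kappa> (i + 1))"

definition K_mat :: "nat \<Rightarrow> complex \<Rightarrow> complex \<Rightarrow> complex mat \<Rightarrow> complex mat" where
  "K_mat d q \<nu> R = (inverse (q - inverse q) * inverse \<nu>) \<cdot>\<^sub>m
     ((q \<cdot>\<^sub>m 1\<^sub>m (d ^ 2) - R) * (inverse q \<cdot>\<^sub>m 1\<^sub>m (d ^ 2) + R))"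

definition BMW_type :: "nat \<Rightarrow> complex \<Rightarrow> complex \<Rightarrow> complex mat \<Rightarrow> bool" where
  "BMW_type d q \<nu> R \<longleftrightarrow> R_matrix d R \<and>
     (\<exists>p. is_minimal_poly p R \<and> degree p = 3) \<and>
     (\<forall>n. \<exists>e'. BMW_representation q \<nu> n (d ^ n)
        (\<lambda>i. on_adjacent d n i R) e' (\<lambda>i. on_adjacent d n i (K_mat d q \<nu> R)))"

end

theory Submission
  imports Defs
begin

text \<open>
  Write \<open>K\<^bsup>ab\<^esup>\<^bsub>xy\<^esub>\<close> for the components of \<open>K\<close>. The relation \<open>K\<^sub>2 R\<^sub>1 K\<^sub>2 = \<nu>\<^sup>-\<^sup>1 K\<^sub>2\<close> determines the partial
  trace over the second factor of \<open>R (I \<otimes> T)\<close>, where \<open>T\<close> is the contraction of two copies of \<open>K\<close> along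
  one index. The skew inverse \<open>\<Psi>\<close> inverts \<open>T \<mapsto> Tr\<^sub>(\<^sub>2\<^sub>) (R (I \<otimes> T))\<close>, so that
  \<open>\<Sum>\<^sub>z K\<^bsup>ab\<^esup>\<^bsub>xz\<^esub> K\<^bsup>yz\<^esup>\<^bsub>mn\<^esub> = \<nu>\<^sup>-\<^sup>1 K\<^bsup>ab\<^esup>\<^bsub>mn\<^esub> D\<^bsup>y\<^esup>\<^bsub>x\<^esub>\<close> with \<open>D = Tr\<^sub>(\<^sub>2\<^sub>) \<Psi>\<close>. If \<open>D v = 0\<close>, then inserting this
  into \<open>K\<^sub>1 K\<^sub>2 K\<^sub>1 = K\<^sub>1\<close> shows that \<open>v\<close> is annihilated by the first lower index of \<open>K\<close>, and inserting that
  into \<open>K\<^sub>2 K\<^sub>1 K\<^sub>2 = K\<^sub>2\<close> gives \<open>v = 0\<close>, because \<open>K \<noteq> 0\<close>. Hence \<open>D\<close> is invertible. If \<open>K\<^bsup>ab\<^esup>\<^bsub>mn\<^esub> \<noteq> 0\<close>, then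
  the matrix \<open>(K\<^bsup>yz\<^esup>\<^bsub>mn\<^esub>)\<^bsub>y,z\<^esub>\<close> is invertible as a left factor of a multiple of \<open>D\<close>, and the contraction
  identity shows that all rows of \<open>K\<close> are proportional to the row \<open>ab\<close>.
\<close>

subsection \<open>Components of operators on three tensor factors\<close>

(* Keeps factor numbers such as the 1 in on_factors d 3 1 2 from being rewritten to Suc 0. *)
declare One_nat_def [simp del]

section \<open>Base-\<open>d\<close> digits of indices\<close>

lemma sum_mult_digits:
  fixes f :: "nat \<Rightarrow> 'a::comm_monoid_add"
  shows "(\<Sum>x<m * d. f x) = (\<Sum>a<m. \<Sum>b<d. f (a * d + b))"
proof -
  have "(\<Sum>x = a * d..<a * d + d. f x) = (\<Sum>b<d. f (a * d + b))" for a
    using sum.shift_bounds_nat_ivl[of f 0 "a * d" d] by (simp add: atLeast0LessThan add.commute)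
  then show ?thesis
    by (simp add: sum.nat_group[symmetric])
qed

lemma digits_less:
  assumes "a < m" "b < (d::nat)"
  shows "a * d + b < m * d"
proof -
  have "a * d + b < a * d + d" using assms by simp
  also have "\<dots> = (a + 1) * d" by (simp add: algebra_simps)
  also have "\<dots> \<le> m * d" using assms by (intro mult_right_mono) auto
  finally show ?thesis .
qed

lemma digits2_less:
  "a < d \<Longrightarrow> b < d \<Longrightarrow> a * (d::nat) + b < d ^ 2"
  unfolding power2_eq_square by (rule digits_less)

lemma digits3_less:
  "a < d \<Longrightarrow> b < d \<Longrightarrow> c < d \<Longrightarrow> (a * (d::nat) + b) * d + c < d ^ 3"
  unfolding power3_eq_cube by (intro digits_less)

lemma sum_digits3:
  fixes f :: "nat \<Rightarrow> 'a::comm_monoid_add"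
  shows "(\<Sum>x<d ^ 3. f x) = (\<Sum>a<d. \<Sum>b<d. \<Sum>c<d. f ((a * d + b) * d + c))"
  by (simp add: power3_eq_cube sum_mult_digits)

lemma tensor_digit2:
  assumes "a < d" "b < d"
  shows "tensor_digit d 2 1 (a * d + b) = a" "tensor_digit d 2 2 (a * d + b) = b"
  using assms by (auto simp: tensor_digit_def)

lemma tensor_digit3:
  assumes "a < d" "b < d" "c < d"
  shows "tensor_digit d 3 1 ((a * d + b) * d + c) = a"
    "tensor_digit d 3 2 ((a * d + b) * d + c) = b"
    "tensor_digit d 3 3 ((a * d + b) * d + c) = c"
proof -
  have "((a * d + b) * d + c) div d ^ 2 = a"
    using assms by (simp add: power2_eq_square div_mult2_eq)
  then show "tensor_digit d 3 1 ((a * d + b) * d + c) = a"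
    using assms by (simp add: tensor_digit_def)
qed (use assms in \<open>auto simp: tensor_digit_def\<close>)

section \<open>Entries of operators on two neighbouring factors, and of their products\<close>

lemma on_factors_carrier: "on_factors d n k l X \<in> carrier_mat (d ^ n) (d ^ n)"
  by (simp add: on_factors_def)

lemma on_adjacent_3_1_index:
  assumes "a < d" "b < d" "c < d" "a' < d" "b' < d" "c' < d"
  shows "on_factors d 3 1 2 X $$ ((a * d + b) * d + c, (a' * d + b') * d + c') =
    (if c = c' then X $$ (a * d + b, a' * d + b') else 0)"
proof -
  have "{1..3} - {1, 2} = {3::nat}" by auto
  then show ?thesis
    unfolding on_factors_def using assms by (simp add: digits3_less tensor_digit3)
qed

lemma on_adjacent_3_2_index:
  assumes "a < d" "b < d" "c < d" "a' < d" "b' < d" "c' < d"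
  shows "on_factors d 3 2 3 X $$ ((a * d + b) * d + c, (a' * d + b') * d + c') =
    (if a = a' then X $$ (b * d + c, b' * d + c') else 0)"
proof -
  have "{1..3} - {2, 3} = {1::nat}" by auto
  then show ?thesis
    unfolding on_factors_def using assms by (simp add: digits3_less tensor_digit3)
qed

text \<open>The left factor fixes the third digit, so the sum over \<open>d ^ 3\<close> intermediate
  indices collapses to two digits. \<open>M\<close> is arbitrary, so that a product bracketed to the
  right unfolds one factor at a time.\<close>

lemma on_adjacent_3_1_mult_index:
  assumes "a < d" "b < d" "c < d" "j < d ^ 3" "M \<in> carrier_mat (d ^ 3) (d ^ 3)"
  shows "(on_factors d 3 1 2 X * M) $$ ((a * d + b) * d + c, j) =
    (\<Sum>g<d. \<Sum>h<d. X $$ (a * d + b, g * d + h) * M $$ ((g * d + h) * d + c, j))"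
proof -
  have "(on_factors d 3 1 2 X * M) $$ ((a * d + b) * d + c, j) =
      (\<Sum>x<d ^ 3. on_factors d 3 1 2 X $$ ((a * d + b) * d + c, x) * M $$ (x, j))"
    using assms on_factors_carrier[of d 3 1 2 X]
    by (simp add: digits3_less scalar_prod_def atLeast0LessThan)
  also have "\<dots> = (\<Sum>g<d. \<Sum>h<d. \<Sum>i<d.
      (if c = i then X $$ (a * d + b, g * d + h) else 0) * M $$ ((g * d + h) * d + i, j))"
    unfolding sum_digits3 by (intro sum.cong refl) (simp add: assms on_adjacent_3_1_index)
  also have "\<dots> = (\<Sum>g<d. \<Sum>h<d. X $$ (a * d + b, g * d + h) * M $$ ((g * d + h) * d + c, j))"
    using assms by (simp add: if_distrib[of "\<lambda>x. x * _"] cong: if_cong)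
  finally show ?thesis .
qed

lemma on_adjacent_3_2_mult_index:
  assumes "a < d" "b < d" "c < d" "j < d ^ 3" "M \<in> carrier_mat (d ^ 3) (d ^ 3)"
  shows "(on_factors d 3 2 3 X * M) $$ ((a * d + b) * d + c, j) =
    (\<Sum>g<d. \<Sum>h<d. X $$ (b * d + c, g * d + h) * M $$ ((a * d + g) * d + h, j))"
proof -
  have "(on_factors d 3 2 3 X * M) $$ ((a * d + b) * d + c, j) =
      (\<Sum>x<d ^ 3. on_factors d 3 2 3 X $$ ((a * d + b) * d + c, x) * M $$ (x, j))"
    using assms on_factors_carrier[of d 3 2 3 X]
    by (simp add: digits3_less scalar_prod_def atLeast0LessThan)
  also have "\<dots> = (\<Sum>i<d. \<Sum>g<d. \<Sum>h<d.
      (if a = i then X $$ (b * d + c, g * d + h) * M $$ ((i * d + g) * d + h, j) else 0))"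
    unfolding sum_digits3 by (intro sum.cong refl) (simp add: assms on_adjacent_3_2_index)
  also have "\<dots> = (\<Sum>i<d. (if a = i then \<Sum>g<d. \<Sum>h<d. X $$ (b * d + c, g * d + h) * M $$ ((i * d + g) * d + h, j) else 0))"
    by (intro sum.cong refl) auto
  also have "\<dots> = (\<Sum>g<d. \<Sum>h<d. X $$ (b * d + c, g * d + h) * M $$ ((a * d + g) * d + h, j))"
    using assms by simp
  finally show ?thesis .
qed

text \<open>\<open>X\<close> joins the digits \<open>b c\<close> to \<open>g h\<close>,
  \<open>Y\<close> joins \<open>a g\<close> to \<open>a' i\<close>, and \<open>Z\<close> joins
  \<open>i h\<close> to \<open>b' c'\<close>; only \<open>Y\<close> touches the first factor. This
  turns relations like \<open>k2 * k1 * k2 = k2\<close> into component identities.\<close>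

lemma on_adjacent_3_212_index:
  assumes "a < d" "b < d" "c < d" "a' < d" "b' < d" "c' < d"
  shows "(on_factors d 3 2 3 X * on_factors d 3 1 2 Y * on_factors d 3 2 3 Z) $$
      ((a * d + b) * d + c, (a' * d + b') * d + c') =
    (\<Sum>g<d. \<Sum>h<d. X $$ (b * d + c, g * d + h) *
      (\<Sum>i<d. Y $$ (a * d + g, a' * d + i) * Z $$ (i * d + h, b' * d + c')))"
proof -
  have "on_factors d 3 2 3 X * on_factors d 3 1 2 Y * on_factors d 3 2 3 Z =
      on_factors d 3 2 3 X * (on_factors d 3 1 2 Y * on_factors d 3 2 3 Z)"
    by (rule assoc_mult_mat[OF on_factors_carrier on_factors_carrier on_factors_carrier])
  \<comment> \<open>\<open>Z\<close> fixes the first digit, which forces \<open>j = a'\<close>; the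
    swap makes the sum over \<open>j\<close> innermost, where the delta removes it.\<close>
  moreover have "(\<Sum>j<d. \<Sum>i<d. Y $$ (a * d + g, j * d + i) *
        (if j = a' then Z $$ (i * d + h, b' * d + c') else 0)) =
      (\<Sum>i<d. Y $$ (a * d + g, a' * d + i) * Z $$ (i * d + h, b' * d + c'))" for g h
    by (subst sum.swap) (simp add: if_distrib[of "\<lambda>x. _ * x"] assms cong: if_cong)
  ultimately show ?thesis
    using assms
    by (simp add: on_adjacent_3_2_mult_index on_adjacent_3_1_mult_index on_adjacent_3_2_index
        on_factors_carrier mult_carrier_mat[OF on_factors_carrier on_factors_carrier] digits3_less)
qed

lemma on_adjacent_3_121_index:
  assumes "a < d" "b < d" "c < d" "a' < d" "b' < d" "c' < d"
  shows "(on_factors d 3 1 2 X * on_factors d 3 2 3 Y * on_factors d 3 1 2 Z) $$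
      ((a * d + b) * d + c, (a' * d + b') * d + c') =
    (\<Sum>g<d. \<Sum>h<d. X $$ (a * d + b, g * d + h) *
      (\<Sum>i<d. Y $$ (h * d + c, i * d + c') * Z $$ (g * d + i, a' * d + b')))"
proof -
  have "on_factors d 3 1 2 X * on_factors d 3 2 3 Y * on_factors d 3 1 2 Z =
      on_factors d 3 1 2 X * (on_factors d 3 2 3 Y * on_factors d 3 1 2 Z)"
    by (rule assoc_mult_mat[OF on_factors_carrier on_factors_carrier on_factors_carrier])
  moreover have "(\<Sum>i<d. \<Sum>j<d. Y $$ (h * d + c, i * d + j) *
        (if j = c' then Z $$ (g * d + i, a' * d + b') else 0)) =
      (\<Sum>i<d. Y $$ (h * d + c, i * d + c') * Z $$ (g * d + i, a' * d + b'))" for g h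
    by (simp add: if_distrib[of "\<lambda>x. _ * x"] assms cong: if_cong)
  ultimately show ?thesis
    using assms
    by (simp add: on_adjacent_3_2_mult_index on_adjacent_3_1_mult_index on_adjacent_3_1_index
        on_factors_carrier mult_carrier_mat[OF on_factors_carrier on_factors_carrier] digits3_less)
qed

text \<open>The trace identifies the row digit \<open>b\<close> of \<open>X\<close> with the column
  digit of \<open>Y\<close>, and the product joins the two along \<open>g\<close>. Skew
  invertibility is read in this form.\<close>

lemma partial_trace_12_23_index:
  assumes "a < d" "c < d" "a' < d" "c' < d"
  shows "partial_trace d 3 2 (on_factors d 3 1 2 X * on_factors d 3 2 3 Y) $$
      (a * d + c, a' * d + c') =
    (\<Sum>b<d. \<Sum>g<d. X $$ (a * d + b, a' * d + g) * Y $$ (g * d + c, b * d + c'))"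
proof -
  have ins: "insert_digit d 3 2 b (a * d + c) = (a * d + b) * d + c" if "c < d" for a b c
    using that by (simp add: insert_digit_def)
  have "(\<Sum>j<d. \<Sum>i<d. X $$ (a * d + b, j * d + i) *
        (if j = a' then Y $$ (i * d + c, b * d + c') else 0)) =
      (\<Sum>i<d. X $$ (a * d + b, a' * d + i) * Y $$ (i * d + c, b * d + c'))" for b
    by (subst sum.swap) (simp add: if_distrib[of "\<lambda>x. _ * x"] assms cong: if_cong)
  then show ?thesis
    using assms
    by (simp add: partial_trace_def digits2_less ins on_adjacent_3_1_mult_index
        on_adjacent_3_2_index on_factors_carrier digits3_less)
qed

lemma flip_mat_index:
  assumes "a < d" "b < d" "a' < d" "b' < d"
  shows "flip_mat d $$ (a * d + b, a' * d + b') = (if a = b' \<and> b = a' then 1 else 0)"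
  using assms by (simp add: flip_mat_def digits2_less tensor_digit2)

subsection \<open>The contraction identity forces rank one\<close>

lemma sum_rotate4:
  fixes F :: "'a \<Rightarrow> 'b \<Rightarrow> 'c \<Rightarrow> 'd \<Rightarrow> 'e::comm_monoid_add"
  shows "(\<Sum>x\<in>S. \<Sum>a\<in>A. \<Sum>b\<in>B. \<Sum>c\<in>C. F x a b c) =
    (\<Sum>a\<in>A. \<Sum>b\<in>B. \<Sum>c\<in>C. \<Sum>x\<in>S. F x a b c)"
proof -
  have "(\<Sum>x\<in>S. \<Sum>a\<in>A. \<Sum>b\<in>B. \<Sum>c\<in>C. F x a b c) =
      (\<Sum>a\<in>A. \<Sum>x\<in>S. \<Sum>b\<in>B. \<Sum>c\<in>C. F x a b c)" by (rule sum.swap)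
  also have "\<dots> = (\<Sum>a\<in>A. \<Sum>b\<in>B. \<Sum>x\<in>S. \<Sum>c\<in>C. F x a b c)"
    by (intro sum.cong refl sum.swap)
  also have "\<dots> = (\<Sum>a\<in>A. \<Sum>b\<in>B. \<Sum>c\<in>C. \<Sum>x\<in>S. F x a b c)"
    by (intro sum.cong refl sum.swap)
  finally show ?thesis .
qed

lemma mult_mat_vec_index_sum:
  assumes "v \<in> carrier_vec n" "i < m"
  shows "(mat m n f *\<^sub>v v) $ i = (\<Sum>j<n. f (i, j) * v $ j)"
  using assms by (simp add: scalar_prod_def atLeast0LessThan)

lemma det_nonzero_vecD:
  fixes f :: "nat \<times> nat \<Rightarrow> 'a::field"
  assumes "det (mat n n f) \<noteq> 0" "\<And>i. i < n \<Longrightarrow> (\<Sum>j<n. f (i, j) * z j) = 0" "j < n"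
  shows "z j = 0"
proof -
  have "mat n n f *\<^sub>v vec n z = 0\<^sub>v n"
    by (rule eq_vecI) (auto simp: scalar_prod_def atLeast0LessThan assms(2))
  then have "vec n z = 0\<^sub>v n"
    using assms(1) det_0_iff_vec_prod_zero_field[OF mat_carrier] vec_carrier by metis
  then show ?thesis
    using assms(3) by (metis index_vec index_zero_vec(1))
qed

lemma det_nonzeroI:
  fixes f :: "nat \<times> nat \<Rightarrow> 'a::field"
  assumes "\<And>z j. (\<And>i. i < n \<Longrightarrow> (\<Sum>j<n. f (i, j) * z j) = 0) \<Longrightarrow> j < n \<Longrightarrow> z j = 0"
  shows "det (mat n n f) \<noteq> 0"
proof
  assume "det (mat n n f) = 0"
  then obtain v where v: "v \<in> carrier_vec n" "v \<noteq> 0\<^sub>v n" "mat n n f *\<^sub>v v = 0\<^sub>v n"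
    using det_0_iff_vec_prod_zero_field[of "mat n n f" n] by auto
  have "(\<Sum>j<n. f (i, j) * v $ j) = 0" if "i < n" for i
    using mult_mat_vec_index_sum[OF v(1) that, of f] v(3) that by simp
  then have "v $ j = 0" if "j < n" for j using assms that by blast
  then show False using v by auto
qed

text \<open>\<open>k a b x y\<close> has upper indices \<open>a b\<close> and lower indices
  \<open>x y\<close>. Pairing \<open>contr\<close> with a kernel vector of \<open>D\<close> gives
  zero; the two Temperley-Lieb relations carry this over to the vector itself, times a nonzero
  component.\<close>

lemma contraction_det_nonzero:
  fixes k :: "nat \<Rightarrow> nat \<Rightarrow> nat \<Rightarrow> nat \<Rightarrow> 'a::field"
  assumes contr: "\<And>a b x y l n. \<lbrakk>a < d; b < d; x < d; y < d; l < d; n < d\<rbrakk> \<Longrightarrow>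
      (\<Sum>z<d. k a b x z * k y z l n) = s * k a b l n * D y x"
    and TL121: "\<And>a b c a' b' c'. \<lbrakk>a < d; b < d; c < d; a' < d; b' < d; c' < d\<rbrakk> \<Longrightarrow>
      (\<Sum>g<d. \<Sum>h<d. k a b g h * (\<Sum>i<d. k h c i c' * k g i a' b')) =
      (if c = c' then k a b a' b' else 0)"
    and TL212: "\<And>a b c a' b' c'. \<lbrakk>a < d; b < d; c < d; a' < d; b' < d; c' < d\<rbrakk> \<Longrightarrow>
      (\<Sum>g<d. \<Sum>h<d. k b c g h * (\<Sum>i<d. k a g a' i * k i h b' c')) =
      (if a = a' then k b c b' c' else 0)"
    and nz: "a0 < d" "b0 < d" "l0 < d" "n0 < d" "k a0 b0 l0 n0 \<noteq> 0"
  shows "det (mat d d (\<lambda>(x, y). D x y)) \<noteq> 0"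
proof (rule det_nonzeroI)
  fix v j
  assume "\<And>i. i < d \<Longrightarrow> (\<Sum>j<d. (case (i, j) of (x, y) \<Rightarrow> D x y) * v j) = 0"
  then have ker: "(\<Sum>x<d. D y x * v x) = 0" if "y < d" for y
    using that by simp
  have contr0: "(\<Sum>z<d. \<Sum>x<d. k a b x z * v x * k y z l n) = 0"
    if "a < d" "b < d" "y < d" "l < d" "n < d" for a b y l n
  proof -
    have "(\<Sum>z<d. \<Sum>x<d. k a b x z * v x * k y z l n) =
        (\<Sum>x<d. (\<Sum>z<d. k a b x z * k y z l n) * v x)"
      by (subst sum.swap) (simp add: sum_distrib_left mult_ac)
    also have "\<dots> = (\<Sum>x<d. s * k a b l n * (D y x * v x))"
      using that by (intro sum.cong refl) (simp add: contr mult_ac)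
    also have "\<dots> = 0"
      using that by (simp add: sum_distrib_left[symmetric] ker)
    finally show ?thesis .
  qed
  have kv: "(\<Sum>x<d. k a b x f * v x) = 0" if "a < d" "b < d" "f < d" for a b f
  proof -
    let ?w = "\<lambda>c. \<Sum>x<d. k a b x c * v x"
    \<comment> \<open>\<open>TL121\<close> at \<open>a0 b0\<close> and \<open>l0 n0\<close> supplies
      the delta \<open>c = f\<close> with a nonzero factor. Once the sum over \<open>c\<close> is
      moved inside, it has the form treated by \<open>contr0\<close>.\<close>
    have "k a0 b0 l0 n0 * ?w f = (\<Sum>c<d. (if c = f then k a0 b0 l0 n0 else 0) * ?w c)"
      using that by (simp add: if_distrib[of "\<lambda>x. x * _"] cong: if_cong)
    also have "\<dots> = (\<Sum>c<d. \<Sum>g<d. \<Sum>h<d. \<Sum>i<d.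
        k a0 b0 g h * k g i l0 n0 * (?w c * k h c i f))"
      using that nz
      by (intro sum.cong refl)
        (simp add: TL121[symmetric] sum_distrib_left sum_distrib_right mult_ac)
    also have "\<dots> = (\<Sum>g<d. \<Sum>h<d. \<Sum>i<d. k a0 b0 g h * k g i l0 n0 *
        (\<Sum>c<d. \<Sum>x<d. k a b x c * v x * k h c i f))"
      by (subst sum_rotate4) (simp add: sum_distrib_left sum_distrib_right)
    also have "\<dots> = 0"
      using that by (intro sum.neutral ballI) (simp add: contr0)
    finally show ?thesis using nz by simp
  qed
  assume j: "j < d"
  \<comment> \<open>Now \<open>TL212\<close> supplies the delta \<open>j = x\<close>, and the inner
    sum over \<open>x\<close> vanishes by \<open>kv\<close>.\<close>
  have "k a0 b0 l0 n0 * v j = (\<Sum>x<d. (if j = x then k a0 b0 l0 n0 else 0) * v x)"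
    using j by (simp add: if_distrib[of "\<lambda>x. x * _"] cong: if_cong)
  also have "\<dots> = (\<Sum>x<d. \<Sum>g<d. \<Sum>h<d. \<Sum>i<d.
      k a0 b0 g h * k i h l0 n0 * (k j g x i * v x))"
    using j nz
    by (intro sum.cong refl)
      (simp add: TL212[symmetric] sum_distrib_left sum_distrib_right mult_ac)
  also have "\<dots> = (\<Sum>g<d. \<Sum>h<d. \<Sum>i<d. k a0 b0 g h * k i h l0 n0 * (\<Sum>x<d. k j g x i * v x))"
    by (subst sum_rotate4) (simp add: sum_distrib_left)
  also have "\<dots> = 0"
    using j by (intro sum.neutral ballI) (simp add: kv)
  finally show "v j = 0" using nz by simp
qed

text \<open>These are the 2 by 2 minors through the pivot \<open>k a0 b0 l0 n0\<close>. For fixed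
  \<open>x\<close>, the difference of the two sides, as a vector indexed by \<open>y\<close>, is
  killed by the invertible matrix \<open>U\<close>.\<close>

lemma contraction_minors_vanish:
  fixes k :: "nat \<Rightarrow> nat \<Rightarrow> nat \<Rightarrow> nat \<Rightarrow> 'a::field"
  assumes contr: "\<And>a b x y l n. \<lbrakk>a < d; b < d; x < d; y < d; l < d; n < d\<rbrakk> \<Longrightarrow>
      (\<Sum>z<d. k a b x z * k y z l n) = s * k a b l n * D y x"
    and det: "det (mat d d (\<lambda>(x, y). D x y)) \<noteq> 0" and s: "s \<noteq> 0"
    and nz: "a0 < d" "b0 < d" "l0 < d" "n0 < d" "k a0 b0 l0 n0 \<noteq> 0"
    and ab: "a < d" "b < d" "x < d" "y < d"
  shows "k a0 b0 l0 n0 * k a b x y = k a b l0 n0 * k a0 b0 x y"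
proof -
  define U where "U = mat d d (\<lambda>(x, y). k x y l0 n0)"
  define W where "W = mat d d (\<lambda>(y, x). k a0 b0 x y)"
  \<comment> \<open>Entry \<open>(y, x)\<close> is \<open>contr\<close> for the upper pair
    \<open>a0 b0\<close> and the lower pair \<open>l0 n0\<close>; \<open>W\<close> is transposed so
    that the contracted index comes first.\<close>
  have "U * W = (s * k a0 b0 l0 n0) \<cdot>\<^sub>m mat d d (\<lambda>(x, y). D x y)"
    using nz contr by (intro eq_matI)
      (auto simp: U_def W_def scalar_prod_def atLeast0LessThan mult.commute[of "k _ _ l0 n0"])
  moreover have "det (U * W) = det U * det W"
    by (rule det_mult[of _ d]) (auto simp: U_def W_def)
  ultimately have "det U \<noteq> 0"
    using det s nz by auto
  \<comment> \<open>By \<open>contr\<close> both contractions are multiples of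
    \<open>s * D i x\<close>, with coefficients \<open>k a b l0 n0\<close> and
    \<open>k a0 b0 l0 n0\<close>; the crossed weights make them cancel.\<close>
  moreover have "(\<Sum>z<d. k i z l0 n0 *
      (k a0 b0 l0 n0 * k a b x z - k a b l0 n0 * k a0 b0 x z)) = 0" if "i < d" for i
  proof -
    have "(\<Sum>z<d. k i z l0 n0 * (k a0 b0 l0 n0 * k a b x z - k a b l0 n0 * k a0 b0 x z)) =
        k a0 b0 l0 n0 * (\<Sum>z<d. k a b x z * k i z l0 n0) -
        k a b l0 n0 * (\<Sum>z<d. k a0 b0 x z * k i z l0 n0)"
      by (simp add: sum_distrib_left sum_subtractf algebra_simps)
    also have "\<dots> = 0"
      using that ab nz by (simp add: contr)
    finally show ?thesis .
  qed
  ultimately have "k a0 b0 l0 n0 * k a b x y - k a b l0 n0 * k a0 b0 x y = 0"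
    using det_nonzero_vecD[of d "\<lambda>(x, y). k x y l0 n0"
        "\<lambda>z. k a0 b0 l0 n0 * k a b x z - k a b l0 n0 * k a0 b0 x z" y] ab
    unfolding U_def by simp
  then show ?thesis by simp
qed

text \<open>The product form bounds the rank from above; a nonzero entry lies in a nonzero column,
  which is independent by itself.\<close>

lemma (in vec_space) rank_eq_1_product_entries:
  assumes A: "A \<in> carrier_mat n nc"
    and fg: "\<And>r c. r < n \<Longrightarrow> c < nc \<Longrightarrow> A $$ (r, c) = f r * g c"
    and nz: "A \<noteq> 0\<^sub>m n nc"
  shows "rank A = 1"
proof (rule antisym)
  show "rank A \<le> 1"
    using A fg by (intro rank_le_1_product_entries[of A nc f g]) auto
  obtain i j where ij: "i < n" "j < nc" "A $$ (i, j) \<noteq> 0"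
    using nz A by (auto simp: mat_eq_iff)
  then have v: "col A j \<in> carrier_vec n" "col A j \<noteq> 0\<^sub>v n" "col A j \<in> set (cols A)"
    using A by (auto simp: cols_def vec_eq_iff)
  have "lin_indpt {col A j}"
  proof -
    have "lin_indpt {}"
      using subset_li_is_li finite_basis_exists[OF fin_dim] unfolding basis_def by blast
    moreover have "col A j \<notin> span {}"
      using v by (simp add: span_empty)
    ultimately show ?thesis
      using lin_dep_iff_in_span[of "{}" "col A j"] v by simp
  qed
  then show "1 \<le> rank A"
    using rank_ge_card_indpt[OF A, of "{col A j}"] v by simp
qed

subsection \<open>Relations of the Birman-Murakami-Wenzl algebra\<close>

(* Simp cannot guess the dimensions of compound factors, hence the version with all of them fixed. *)
lemmas square_mat_simps =
  assoc_mult_mat[where n\<^sub>1 = N and n\<^sub>2 = N and n\<^sub>3 = N and n\<^sub>4 = N]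
  add_mult_distrib_mat[where nr = N and n = N and nc = N]
  mult_add_distrib_mat[where nr = N and n = N and nc = N]
  minus_mult_distrib_mat[where nr = N and n = N and nc = N]
  mult_minus_distrib_mat[where nr = N and n = N and nc = N]
  mult_smult_distrib[where nr = N and n = N and nc = N]
  mult_smult_assoc_mat[where nr = N and n = N and nc = N]
  minus_carrier_mat[where nr = N and nc = N]
  for N

text \<open>Multiply \<open>ek\<close> and \<open>sq\<close> by \<open>e'\<close> from the left. The
  second identity is the Kauffman skein relation, the difference \<open>e - e'\<close> being
  \<open>l\<close> times \<open>1 - k\<close>.\<close>

lemma BMW_kappa_skein:
  fixes e e' k :: "'a::field mat"
  assumes c: "e \<in> carrier_mat N N" "e' \<in> carrier_mat N N" "k \<in> carrier_mat N N"
    and inv: "e' * e = 1\<^sub>m N"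
    and sq: "e * e = 1\<^sub>m N + l \<cdot>\<^sub>m (e - \<nu> \<cdot>\<^sub>m k)" and ek: "e * k = \<nu> \<cdot>\<^sub>m k"
    and \<nu>: "\<nu> \<noteq> 0"
  shows "e' * k = inverse \<nu> \<cdot>\<^sub>m k" "l \<cdot>\<^sub>m k = l \<cdot>\<^sub>m 1\<^sub>m N + e' - e"
proof -
  have "k = e' * (e * k)"
    using c inv by (simp flip: assoc_mult_mat)
  also have "\<dots> = \<nu> \<cdot>\<^sub>m (e' * k)"
    using c by (simp add: ek mult_smult_distrib)
  finally have "inverse \<nu> \<cdot>\<^sub>m k = inverse \<nu> \<cdot>\<^sub>m (\<nu> \<cdot>\<^sub>m (e' * k))" by simp
  also have "\<dots> = e' * k"
    using \<nu> by (intro eq_matI) auto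
  finally show e'k: "e' * k = inverse \<nu> \<cdot>\<^sub>m k" by simp
  have "e = e' * (e * e)"
    using c inv by (simp flip: assoc_mult_mat)
  also have "\<dots> = e' + l \<cdot>\<^sub>m (1\<^sub>m N - \<nu> \<cdot>\<^sub>m (e' * k))"
    using c by (simp add: sq square_mat_simps[where N = N] inv)
  also have "\<nu> \<cdot>\<^sub>m (e' * k) = k"
    using c \<nu> by (intro eq_matI) (auto simp: e'k)
  finally have e: "e = e' + l \<cdot>\<^sub>m (1\<^sub>m N - k)" .
  have "e $$ (i, j) = e' $$ (i, j) + l * (1\<^sub>m N $$ (i, j) - k $$ (i, j))" if "i < N" "j < N" for i j
    by (subst e) (use that c in simp)
  then show "l \<cdot>\<^sub>m k = l \<cdot>\<^sub>m 1\<^sub>m N + e' - e"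
    using c by (intro eq_matI) (auto simp: algebra_simps)
qed

lemma smult_mat_cancel:
  fixes A B :: "'a::field mat"
  assumes "a \<noteq> 0" "a \<cdot>\<^sub>m A = a \<cdot>\<^sub>m B"
  shows "A = B"
proof -
  have "inverse a \<cdot>\<^sub>m (a \<cdot>\<^sub>m A) = inverse a \<cdot>\<^sub>m (a \<cdot>\<^sub>m B)" using assms by simp
  moreover have "inverse a \<cdot>\<^sub>m (a \<cdot>\<^sub>m C) = C" for C using assms by (intro eq_matI) auto
  ultimately show ?thesis by simp
qed

text \<open>The skein relation replaces the middle \<open>k1\<close> by \<open>1\<close>,
  \<open>e1'\<close> and \<open>e1\<close>, whose sandwiches between two copies of \<open>k2\<close>
  are known multiples of \<open>k2\<close>; the terms with \<open>\<nu>\<close> and its inverse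
  cancel.\<close>

lemma BMW_kappa_212:
  fixes e1 e1' k1 e2 e2' k2 :: "'a::field mat"
  assumes c: "e1 \<in> carrier_mat N N" "e1' \<in> carrier_mat N N" "k1 \<in> carrier_mat N N"
      "e2 \<in> carrier_mat N N" "e2' \<in> carrier_mat N N" "k2 \<in> carrier_mat N N"
    and inv: "e1' * e1 = 1\<^sub>m N" "e2' * e2 = 1\<^sub>m N"
    and sq: "e1 * e1 = 1\<^sub>m N + l \<cdot>\<^sub>m (e1 - \<nu> \<cdot>\<^sub>m k1)" "e2 * e2 = 1\<^sub>m N + l \<cdot>\<^sub>m (e2 - \<nu> \<cdot>\<^sub>m k2)"
    and ek: "e1 * k1 = \<nu> \<cdot>\<^sub>m k1" "e2 * k2 = \<nu> \<cdot>\<^sub>m k2"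
    and kek: "k2 * e1 * k2 = inverse \<nu> \<cdot>\<^sub>m k2" "k2 * e1' * k2 = \<nu> \<cdot>\<^sub>m k2"
    and nz: "l \<noteq> 0" "\<nu> \<noteq> 0"
  shows "k2 * k1 * k2 = k2"
proof -
  have s1: "l \<cdot>\<^sub>m k1 = l \<cdot>\<^sub>m 1\<^sub>m N + e1' - e1"
    using BMW_kappa_skein[OF c(1-3) inv(1) sq(1) ek(1) nz(2)] by simp
  have s2: "e2' * k2 = inverse \<nu> \<cdot>\<^sub>m k2" "l \<cdot>\<^sub>m k2 = l \<cdot>\<^sub>m 1\<^sub>m N + e2' - e2"
    using BMW_kappa_skein[OF c(4-6) inv(2) sq(2) ek(2) nz(2)] by simp_all
  \<comment> \<open>The skein relation for \<open>e2\<close> shows that \<open>k2\<close> is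
    idempotent up to a scalar.\<close>
  have "l \<cdot>\<^sub>m (k2 * k2) = (l \<cdot>\<^sub>m k2) * k2"
    using c by (simp add: mult_smult_assoc_mat)
  also have "\<dots> = (l \<cdot>\<^sub>m 1\<^sub>m N + e2' - e2) * k2"
    unfolding s2(2) ..
  also have "\<dots> = l \<cdot>\<^sub>m k2 + inverse \<nu> \<cdot>\<^sub>m k2 - \<nu> \<cdot>\<^sub>m k2"
    using c ek(2) s2(1)
    by (simp add: square_mat_simps[where N = N])
  finally have kk: "l \<cdot>\<^sub>m (k2 * k2) = l \<cdot>\<^sub>m k2 + inverse \<nu> \<cdot>\<^sub>m k2 - \<nu> \<cdot>\<^sub>m k2" .
  have "l \<cdot>\<^sub>m (k2 * k1 * k2) = k2 * (l \<cdot>\<^sub>m k1) * k2"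
    using c by (simp add: square_mat_simps[where N = N])
  also have "\<dots> = (l \<cdot>\<^sub>m (k2 * k2) + k2 * e1' * k2) - k2 * e1 * k2"
    using c unfolding s1
    by (simp add: square_mat_simps[where N = N])
  also have "\<dots> = l \<cdot>\<^sub>m k2"
    unfolding kk kek using c by (intro eq_matI) auto
  finally show ?thesis
    using smult_mat_cancel nz by blast
qed

text \<open>The quadratic relation makes \<open>l * \<nu>\<close> times \<open>k\<close> a
  polynomial in \<open>e\<close>, the same one for both generators, so whatever intertwines the
  \<open>e\<close> also intertwines the \<open>k\<close>.\<close>

lemma BMW_kappa_intertwine:
  fixes e1 e2 k1 k2 g :: "'a::field mat"
  assumes c: "e1 \<in> carrier_mat N N" "k1 \<in> carrier_mat N N"
      "e2 \<in> carrier_mat N N" "k2 \<in> carrier_mat N N" "g \<in> carrier_mat N N"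
    and sq: "e1 * e1 = 1\<^sub>m N + l \<cdot>\<^sub>m (e1 - \<nu> \<cdot>\<^sub>m k1)" "e2 * e2 = 1\<^sub>m N + l \<cdot>\<^sub>m (e2 - \<nu> \<cdot>\<^sub>m k2)"
    and g: "g * e1 = e2 * g"
    and nz: "l \<noteq> 0" "\<nu> \<noteq> 0"
  shows "g * k1 = k2 * g"
proof -
  have kap: "(l * \<nu>) \<cdot>\<^sub>m k = 1\<^sub>m N + l \<cdot>\<^sub>m e - e * e"
    if "e \<in> carrier_mat N N" "k \<in> carrier_mat N N" "e * e = 1\<^sub>m N + l \<cdot>\<^sub>m (e - \<nu> \<cdot>\<^sub>m k)"
    for e k :: "'a mat"
    unfolding that(3) using that(1,2) by (intro eq_matI) (auto simp: algebra_simps)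
  have gg: "g * (e1 * e1) = (e2 * e2) * g"
  proof -
    have "g * (e1 * e1) = (g * e1) * e1" using c by simp
    also have "\<dots> = (e2 * g) * e1" unfolding g ..
    also have "\<dots> = e2 * (g * e1)" using c by simp
    also have "\<dots> = e2 * (e2 * g)" unfolding g ..
    also have "\<dots> = (e2 * e2) * g" using c by simp
    finally show ?thesis .
  qed
  have "(l * \<nu>) \<cdot>\<^sub>m (g * k1) = g * ((l * \<nu>) \<cdot>\<^sub>m k1)"
    using c by (simp add: mult_smult_distrib)
  also have "\<dots> = g + l \<cdot>\<^sub>m (g * e1) - g * (e1 * e1)"
    unfolding kap[OF c(1,2) sq(1)] using c
    by (simp add: square_mat_simps[where N = N])
  also have "\<dots> = g + l \<cdot>\<^sub>m (e2 * g) - (e2 * e2) * g"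
    unfolding gg g ..
  also have "\<dots> = ((l * \<nu>) \<cdot>\<^sub>m k2) * g"
    unfolding kap[OF c(3,4) sq(2)] using c
    by (simp add: square_mat_simps[where N = N])
  also have "\<dots> = (l * \<nu>) \<cdot>\<^sub>m (k2 * g)"
    using c by (simp add: mult_smult_assoc_mat)
  finally show ?thesis
    using nz smult_mat_cancel[of "l * \<nu>"] by simp
qed

(* Conjugation by the half twist e1 e2 e1 exchanges the two generators. *)
lemma BMW_kappa_121:
  fixes e1 e1' k1 e2 e2' k2 :: "'a::field mat"
  assumes c: "e1 \<in> carrier_mat N N" "e1' \<in> carrier_mat N N" "k1 \<in> carrier_mat N N"
      "e2 \<in> carrier_mat N N" "e2' \<in> carrier_mat N N" "k2 \<in> carrier_mat N N"
    and inv: "e1' * e1 = 1\<^sub>m N" "e2' * e2 = 1\<^sub>m N"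
    and braid: "e1 * e2 * e1 = e2 * e1 * e2"
    and sq: "e1 * e1 = 1\<^sub>m N + l \<cdot>\<^sub>m (e1 - \<nu> \<cdot>\<^sub>m k1)" "e2 * e2 = 1\<^sub>m N + l \<cdot>\<^sub>m (e2 - \<nu> \<cdot>\<^sub>m k2)"
    and nz: "l \<noteq> 0" "\<nu> \<noteq> 0"
    and k212: "k2 * k1 * k2 = k2"
  shows "k1 * k2 * k1 = k1"
proof -
  define g where "g = e1 * e2 * e1"
  define g' where "g' = e1' * e2' * e1'"
  have cg: "g \<in> carrier_mat N N" "g' \<in> carrier_mat N N"
    using c by (auto simp: g_def g'_def)
  have cancel: "e1' * (e1 * X) = X" "e2' * (e2 * X) = X" if "X \<in> carrier_mat N N" for X
    using c that inv by (simp_all flip: assoc_mult_mat)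
  have g'g: "g' * g = 1\<^sub>m N"
    using c by (simp add: g_def g'_def square_mat_simps[where N = N] cancel inv)
  have "g * e1 = e2 * g"
  proof -
    have "g * e1 = e2 * e1 * e2 * e1" by (simp add: g_def braid)
    also have "\<dots> = e2 * g" using c by (simp add: g_def square_mat_simps[where N = N])
    finally show ?thesis .
  qed
  then have gk1: "g * k1 = k2 * g"
    by (rule BMW_kappa_intertwine[OF c(1,3,4,6) cg(1) sq _ nz])
  have "g * e2 = e1 * g"
  proof -
    have "g * e2 = e1 * (e2 * e1 * e2)" using c by (simp add: g_def square_mat_simps[where N = N])
    also have "\<dots> = e1 * g" by (simp add: g_def braid)
    finally show ?thesis .
  qed
  then have gk2: "g * k2 = k1 * g"
    by (rule BMW_kappa_intertwine[OF c(4,6,1,3) cg(1) sq(2,1) _ nz])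
  \<comment> \<open>Moving \<open>g\<close> to the right turns \<open>k1 * k2 * k1\<close> into
    \<open>k2 * k1 * k2\<close>, where \<open>k212\<close> applies; then \<open>g\<close> is
    cancelled.\<close>
  have "g * (k1 * k2 * k1) = (g * k1) * (k2 * k1)" using c cg by (simp add: square_mat_simps[where N = N])
  also have "\<dots> = k2 * ((g * k2) * k1)" unfolding gk1 using c cg by (simp add: square_mat_simps[where N = N])
  also have "\<dots> = k2 * k1 * (g * k1)" unfolding gk2 using c cg by (simp add: square_mat_simps[where N = N])
  also have "\<dots> = (k2 * k1 * k2) * g" unfolding gk1 using c cg by (simp add: square_mat_simps[where N = N])
  also have "\<dots> = g * k1" unfolding k212 gk1 ..
  finally have "g' * (g * (k1 * k2 * k1)) = g' * (g * k1)" by simp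
  moreover have "g' * (g * X) = X" if "X \<in> carrier_mat N N" for X
    using c cg that g'g by (simp flip: assoc_mult_mat)
  ultimately show ?thesis using c by simp
qed

subsection \<open>The rank of the contraction operator\<close>

lemma K_mat_carrier: "R \<in> carrier_mat (d ^ 2) (d ^ 2) \<Longrightarrow> K_mat d q \<nu> R \<in> carrier_mat (d ^ 2) (d ^ 2)"
  by (auto simp: K_mat_def intro!: mult_carrier_mat)

text \<open>If \<open>K\<close> vanished, the quadratic polynomial \<open>?r\<close>, which is the
  expanded product of \<open>q - x\<close> and \<open>inverse q + x\<close>, would annihilate
  \<open>R\<close> and be divisible by the cubic \<open>p\<close>.\<close>

lemma K_mat_nonzero:
  assumes R: "R \<in> carrier_mat (d ^ 2) (d ^ 2)" and q: "q \<noteq> 0" "q - inverse q \<noteq> 0" "\<nu> \<noteq> 0"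
    and p: "is_minimal_poly p R" "degree p = 3"
  shows "K_mat d q \<nu> R \<noteq> 0\<^sub>m (d ^ 2) (d ^ 2)"
proof
  let ?N = "d ^ 2" and ?r = "[:1, q - inverse q, -1:]"
  assume K: "K_mat d q \<nu> R = 0\<^sub>m ?N ?N"
  define Q where "Q = (q \<cdot>\<^sub>m 1\<^sub>m ?N - R) * (inverse q \<cdot>\<^sub>m 1\<^sub>m ?N + R)"
  have cQ: "Q \<in> carrier_mat ?N ?N"
    using R by (auto simp: Q_def)
  have "Q = q \<cdot>\<^sub>m (inverse q \<cdot>\<^sub>m 1\<^sub>m ?N + R) - (inverse q \<cdot>\<^sub>m R + R * R)"
  proof -
    let ?X = "inverse q \<cdot>\<^sub>m 1\<^sub>m ?N + R"
    have X: "?X \<in> carrier_mat ?N ?N" using R by simp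
    have "Q = (q \<cdot>\<^sub>m 1\<^sub>m ?N) * ?X - R * ?X"
      unfolding Q_def using R X by (intro minus_mult_distrib_mat) auto
    moreover have "(q \<cdot>\<^sub>m 1\<^sub>m ?N) * ?X = q \<cdot>\<^sub>m ?X"
      using mult_smult_assoc_mat[OF one_carrier_mat X, of q] left_mult_one_mat[OF X] by simp
    moreover have "R * ?X = inverse q \<cdot>\<^sub>m R + R * R"
      using R by (simp add: square_mat_simps[where N = ?N])
    ultimately show ?thesis by simp
  qed
  then have Qij: "Q $$ (i, j) = 1\<^sub>m ?N $$ (i, j) + (q - inverse q) * R $$ (i, j) - (R * R) $$ (i, j)"
    if "i < ?N" "j < ?N" for i j
    using that R q by (simp add: algebra_simps del: index_mult_mat(1))
  have Q0: "Q $$ (i, j) = 0" if "i < ?N" "j < ?N" for i j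
  proof -
    have "K_mat d q \<nu> R $$ (i, j) = inverse (q - inverse q) * inverse \<nu> * Q $$ (i, j)"
      using that cQ unfolding K_mat_def Q_def[symmetric] by simp
    then show ?thesis using K q that by simp
  qed
  have "annihilates ?r R"
    unfolding annihilates_def poly_at_mat_def
  proof (rule eq_matI)
    fix i j
    assume "i < dim_row (0\<^sub>m (dim_row R) (dim_row R) :: complex mat)"
      "j < dim_col (0\<^sub>m (dim_row R) (dim_row R) :: complex mat)"
    then have ij: "i < ?N" "j < ?N" using R by auto
    have "(\<Sum>k\<le>degree ?r. coeff ?r k * (R ^\<^sub>m k) $$ (i, j)) =
        1\<^sub>m ?N $$ (i, j) + (q - inverse q) * R $$ (i, j) - (R * R) $$ (i, j)"
      using R by (simp add: numeral_2_eq_2 One_nat_def)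
    also have "\<dots> = 0"
      using Qij[OF ij] Q0[OF ij] by simp
    finally show "mat (dim_row R) (dim_row R)
        (\<lambda>(i, j). \<Sum>k\<le>degree ?r. coeff ?r k * (R ^\<^sub>m k) $$ (i, j)) $$ (i, j) =
        0\<^sub>m (dim_row R) (dim_row R) $$ (i, j)"
      using ij R by simp
  qed simp_all
  then have "p dvd ?r"
    using p unfolding is_minimal_poly_def by blast
  then have "degree p \<le> degree ?r"
    by (rule dvd_imp_degree_le) simp
  then show False using p by simp
qed

theorem mainTheorem1:
  fixes d :: nat and R :: "complex mat" and q \<nu> :: complex
  assumes "q \<notin> {0, 1, -1}"
    and "\<nu> \<notin> {0, q, - inverse q}"
    and "R_matrix d R"
    and "skew_invertible d R"
    and "BMW_type d q \<nu> R"
  shows "vec_space.rank (d ^ 2) (K_mat d q \<nu> R) = 1"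
proof -
  define K where "K = K_mat d q \<nu> R"
  define l where "l = q - inverse q"
  have q: "q \<noteq> 0" and \<nu>: "\<nu> \<noteq> 0" using assms(1,2) by auto
  have l: "l \<noteq> 0"
  proof
    assume "l = 0"
    then have "q * q = 1" using q by (simp add: l_def field_simps)
    then show False using assms(1) by (simp add: square_eq_1_iff)
  qed
  have R: "R \<in> carrier_mat (d ^ 2) (d ^ 2)"
    using assms(3) by (simp add: R_matrix_def)
  then have cK: "K \<in> carrier_mat (d ^ 2) (d ^ 2)"
    by (simp add: K_def K_mat_carrier)
  have K0: "K \<noteq> 0\<^sub>m (d ^ 2) (d ^ 2)"
    using assms(5) K_mat_nonzero[OF R q _ \<nu>] l by (auto simp: K_def l_def BMW_type_def)

  \<comment> \<open>The BMW relations on three strands\<close>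
  let ?e1 = "on_factors d 3 1 2 R" and ?e2 = "on_factors d 3 2 3 R"
  let ?k1 = "on_factors d 3 1 2 K" and ?k2 = "on_factors d 3 2 3 K"
  obtain e' where "BMW_representation q \<nu> 3 (d ^ 3) (\<lambda>i. on_adjacent d 3 i R) e' (\<lambda>i. on_adjacent d 3 i K)"
    using assms(5) by (auto simp: BMW_type_def K_def)
  note rep = this[unfolded BMW_representation_def, folded l_def]
  have i12: "1 \<in> {1..<3::nat}" "2 \<in> {1..<3::nat}" "1 + 1 = (2::nat)" "2 + 1 = (3::nat)"
    by simp_all
  have ce': "e' 1 \<in> carrier_mat (d ^ 3) (d ^ 3)" "e' 2 \<in> carrier_mat (d ^ 3) (d ^ 3)"
    using rep i12 by blast+
  have inv: "e' 1 * ?e1 = 1\<^sub>m (d ^ 3)" "e' 2 * ?e2 = 1\<^sub>m (d ^ 3)"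
    using rep i12 by metis+
  have braid: "?e1 * ?e2 * ?e1 = ?e2 * ?e1 * ?e2"
    using rep i12 by metis
  have sq: "?e1 * ?e1 = 1\<^sub>m (d ^ 3) + l \<cdot>\<^sub>m (?e1 - \<nu> \<cdot>\<^sub>m ?k1)"
      "?e2 * ?e2 = 1\<^sub>m (d ^ 3) + l \<cdot>\<^sub>m (?e2 - \<nu> \<cdot>\<^sub>m ?k2)"
    using rep i12 by metis+
  have ek: "?e1 * ?k1 = \<nu> \<cdot>\<^sub>m ?k1" "?e2 * ?k2 = \<nu> \<cdot>\<^sub>m ?k2"
    using rep i12 by metis+
  have kek: "?k2 * ?e1 * ?k2 = inverse \<nu> \<cdot>\<^sub>m ?k2" "?k2 * e' 1 * ?k2 = \<nu> \<cdot>\<^sub>m ?k2"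
    using rep i12 by metis+
  note c = on_factors_carrier
  have k212: "?k2 * ?k1 * ?k2 = ?k2"
    by (rule BMW_kappa_212[OF c ce'(1) c c ce'(2) c inv sq ek kek l \<nu>])
  \<comment> \<open>The defining relations sandwich elements of strand pair \<open>i\<close> between
    copies of \<open>\<kappa> (i + 1)\<close> only; the mirrored identity needs the half
    twist.\<close>
  have k121: "?k1 * ?k2 * ?k1 = ?k1"
    by (rule BMW_kappa_121[OF c ce'(1) c c ce'(2) c inv braid sq l \<nu> k212])

  \<comment> \<open>The relations and the skew inverse in components\<close>
  define k where "k a b x y = K $$ (a * d + b, x * d + y)" for a b x y
  have TL121: "(\<Sum>g<d. \<Sum>h<d. k a b g h * (\<Sum>i<d. k h c i c' * k g i a' b')) =
      (if c = c' then k a b a' b' else 0)"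
    if "a < d" "b < d" "c < d" "a' < d" "b' < d" "c' < d" for a b c a' b' c'
    using on_adjacent_3_121_index[OF that, of K K K] on_adjacent_3_1_index[OF that, of K]
    unfolding k121 k_def by simp
  have TL212: "(\<Sum>g<d. \<Sum>h<d. k b c g h * (\<Sum>i<d. k a g a' i * k i h b' c')) =
      (if a = a' then k b c b' c' else 0)"
    if "a < d" "b < d" "c < d" "a' < d" "b' < d" "c' < d" for a b c a' b' c'
    using on_adjacent_3_212_index[OF that, of K K K] on_adjacent_3_2_index[OF that, of K]
    unfolding k212 k_def by simp
  define r where "r a b x y = R $$ (a * d + b, x * d + y)" for a b x y
  have kek_index: "(\<Sum>g<d. \<Sum>h<d. k b c g h * (\<Sum>i<d. r a g a' i * k i h b' c')) =
      (if a = a' then inverse \<nu> * k b c b' c' else 0)"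
    if "a < d" "b < d" "c < d" "a' < d" "b' < d" "c' < d" for a b c a' b' c'
    using on_adjacent_3_212_index[OF that, of K R K] on_adjacent_3_2_index[OF that, of K]
      that c[of d 3 2 3 K]
    unfolding kek(1) k_def r_def by (auto simp: digits3_less split: if_splits)

  obtain \<Psi> where "partial_trace d 3 2 (on_factors d 3 1 2 \<Psi> * on_factors d 3 2 3 R) = flip_mat d"
    using assms(4) by (auto simp: skew_invertible_def)
  note skew = this
  define \<psi> where "\<psi> a b x y = \<Psi> $$ (a * d + b, x * d + y)" for a b x y
  have \<psi>: "(\<Sum>b<d. \<Sum>g<d. \<psi> a b a' g * r g c b c') = (if a = c' \<and> c = a' then 1 else 0)"
    if "a < d" "c < d" "a' < d" "c' < d" for a c a' c'
    using partial_trace_12_23_index[OF that, of \<Psi> R] flip_mat_index[OF that]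
    unfolding skew \<psi>_def r_def by simp
  define D where "D y x = (\<Sum>b<d. \<psi> y b x b)" for y x

  have contr: "(\<Sum>z<d. k a b x z * k y z m n) = inverse \<nu> * k a b m n * D y x"
    if lt: "a < d" "b < d" "x < d" "y < d" "m < d" "n < d" for a b x y m n
  proof -
    \<comment> \<open>With \<open>a b m n\<close> fixed, \<open>rT\<close> says that tracing
      \<open>R\<close> times \<open>T\<close> on the second factor over that factor gives a multiple
      of the identity.\<close>
    define T where "T i g = (\<Sum>z<d. k a b g z * k i z m n)" for i g
    have rT: "(\<Sum>g<d. \<Sum>i<d. r u g w i * T i g) = (if u = w then inverse \<nu> * k a b m n else 0)"
      if "u < d" "w < d" for u w
    proof -
      have "(\<Sum>i<d. r u g w i * T i g) = (\<Sum>h<d. k a b g h * (\<Sum>i<d. r u g w i * k i h m n))" for g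
        unfolding T_def sum_distrib_left by (subst sum.swap) (simp add: mult_ac)
      then show ?thesis using kek_index[of u a b w m n] that lt by simp
    qed
    \<comment> \<open>The delta is written out so that \<open>\<psi>\<close> can replace it by a sum
      of products of \<open>\<psi>\<close> and \<open>r\<close>.\<close>
    have "T y x = (\<Sum>g<d. \<Sum>i<d. (if y = i \<and> g = x then 1 else 0) * T i g)"
    proof -
      have "(\<Sum>i<d. (if y = i \<and> g = x then 1 else 0) * T i g) = (if g = x then T y g else 0)" for g
        using lt by (simp add: if_distrib[of "\<lambda>x. x * _"] cong: if_cong)
      then show ?thesis using lt by simp
    qed
    also have "\<dots> = (\<Sum>g<d. \<Sum>i<d. \<Sum>w<d. \<Sum>u<d. \<psi> y w x u * (r u g w i * T i g))"
      using lt by (intro sum.cong refl)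
        (simp add: \<psi>[symmetric] sum_distrib_right mult.assoc)
    also have "\<dots> = (\<Sum>w<d. \<Sum>u<d. \<Sum>g<d. \<Sum>i<d. \<psi> y w x u * (r u g w i * T i g))"
      \<comment> \<open>Two rotations exchange the pair \<open>g i\<close> with the pair
        \<open>w u\<close>.\<close>
      by (subst sum_rotate4, subst sum_rotate4) (rule refl)
    also have "\<dots> = (\<Sum>w<d. \<Sum>u<d. \<psi> y w x u * (if u = w then inverse \<nu> * k a b m n else 0))"
      by (intro sum.cong refl) (simp add: sum_distrib_left[symmetric] rT)
    \<comment> \<open>Only \<open>u = w\<close> survives, which closes the second factor of
      \<open>\<Psi>\<close> and produces \<open>D\<close>.\<close>
    also have "\<dots> = inverse \<nu> * k a b m n * D y x"
      by (simp add: D_def sum_distrib_left if_distrib[of "\<lambda>x. _ * x"] mult_ac cong: if_cong)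
    finally show ?thesis unfolding T_def .
  qed

  \<comment> \<open>Factorization of \<open>K\<close> through a nonzero entry\<close>
  obtain i0 j0 where ij0: "i0 < d ^ 2" "j0 < d ^ 2" "K $$ (i0, j0) \<noteq> 0"
    using K0 cK by (auto simp: mat_eq_iff)
  have dig: "i div d < d" "i mod d < d" if "i < d ^ 2" for i
    using that by (auto simp: power2_eq_square less_mult_imp_div_less intro!: mod_less_divisor gr0I)
  have Kk: "K $$ (i, j) = k (i div d) (i mod d) (j div d) (j mod d)" for i j
    by (simp add: k_def)
  note nz = dig[OF ij0(1)] dig[OF ij0(2)] ij0(3)[unfolded Kk]
  have "det (mat d d (\<lambda>(x, y). D x y)) \<noteq> 0"
    by (rule contraction_det_nonzero[where k = k and s = "inverse \<nu>", OF contr TL121 TL212 nz])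
  then have minors: "K $$ (i0, j0) * K $$ (i, j) = K $$ (i, j0) * K $$ (i0, j)"
    if "i < d ^ 2" "j < d ^ 2" for i j
    unfolding Kk using \<nu> dig[OF that(1)] dig[OF that(2)] nz
    by (intro contraction_minors_vanish[where s = "inverse \<nu>" and D = D, OF contr]) auto
  \<comment> \<open>Column \<open>j0\<close> times row \<open>i0\<close> normalized by the
    pivot.\<close>
  have "K $$ (i, j) = K $$ (i, j0) * (K $$ (i0, j) / K $$ (i0, j0))" if "i < d ^ 2" "j < d ^ 2" for i j
    using minors[OF that] ij0(3) by (simp add: field_simps)
  then show ?thesis
    unfolding K_def[symmetric]
    by (rule vec_space.rank_eq_1_product_entries[OF cK _ K0])
qed

end
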